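(* Assume all fluxes $f^k:\mathbb{R}\to\mathbb{R}$, $k\in\mathcal{I}$, are continuous and strictly increasing. Then $\mathcal{L}\subset L^\infty_{\mathrm{oco}}(\mathcal{G}_{\mathrm{disc}})$, where $$\mathcal{L}=\Big\{\mathbf{u}\in L^\infty(\Omega;\lambda)\ :\ u^k(x)\in I_{\mathrm{in}}\ \forall\,k\in\mathcal{I}_{\mathrm{in}},\ u^k(x)\in I_{\mathrm{out}}\ \forall\,k\in\mathcal{I}_{\mathrm{out}}\Big\}.$$ In particular, if $f_{\mathrm{in}}$ and $f_{\mathrm{out}}$ have the same range, $R_{\mathrm{in}}=R_{\mathrm{out}}$, then $L^\infty_{\mathrm{oco}}(\mathcal{G}_{\mathrm{disc}})=L^\infty(\Omega;\lambda)$.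
   Context: **Network.** Fix integers $N_{\mathrm{in}},N_{\mathrm{out}}\geq1$, $N=N_{\mathrm{in}}+N_{\mathrm{out}}$, $\mathcal{I}_{\mathrm{in}}=\{-N_{\mathrm{in}},\dots,-1\}$, $\mathcal{I}_{\mathrm{out}}=\{1,\dots,N_{\mathrm{out}}\}$, $\mathcal{I}=\mathcal{I}_{\mathrm{in}}\cup\mathcal{I}_{\mathrm{out}}$. $D^k=(-\infty,0)$ for $k\in\mathcal{I}_{\mathrm{in}}$, $D^k=(0,\infty)$ for $k\in\mathcal{I}_{\mathrm{out}}$. $\Omega=\bigcup_{k\in\mathcal{I}}D^k\times\{k\}$, $\lambda=$ (Lebesgue)$\times$(counting measure); functions on $\Omega$ are written $\mathbf{u}=(u^k)_{k\in\mathcal{I}}$, and pointwise conditions are understood a.e. **Notation.** $f_{\mathrm{in}}=\sum_{k\in\mathcal{I}_{\mathrm{in}}}f^k$, $f_{\mathrm{out}}=\sum_{k\in\mathcal{I}_{\mathrm{out}}}f^k$ (functions on $\mathbb{R}$), $R_{\mathrm{in}}=f_{\mathrm{in}}(\mathbb{R})$, $R_{\mathrm{out}}=f_{\mathrm{out}}(\mathbb{R})$, $I_{\mathrm{in}}=f_{\mathrm{in}}^{-1}(R_{\mathrm{in}}\cap R_{\mathrm{out}})$, $I_{\mathrm{out}}=f_{\mathrm{out}}^{-1}(R_{\mathrm{in}}\cap R_{\mathrm{out}})$. Standing property: $I_{\mathrm{in}}$ and $I_{\mathrm{out}}$ are closed intervals. **Discrete stationary solutions (upwind method, increasing fluxes).**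 The upwind numerical flux is $F^k(u,v)=f^k(u)$. A discrete stationary solution is a vector $\mathbf{c}=(c^{-N_{\mathrm{in}}},\dots,c^{-1},c^0,c^1,\dots,c^{N_{\mathrm{out}}})\in\mathbb{R}^{N+1}$ with $\sum_{k\in\mathcal{I}_{\mathrm{in}}}f^k(c^k)=\sum_{k\in\mathcal{I}_{\mathrm{out}}}f^k(c^k)$, $F^k(c^k,c^0)=f^k(c^k)$ for $k\in\mathcal{I}_{\mathrm{in}}$ and $F^k(c^0,c^k)=f^k(c^k)$ for $k\in\mathcal{I}_{\mathrm{out}}$. $\mathcal{G}^0_{\mathrm{disc}}$ is the set of all discrete stationary solutions for the upwind method, and $$\mathcal{G}_{\mathrm{disc}}=\{(c^{-N_{\mathrm{in}}},\dots,c^{-1},c^1,\dots,c^{N_{\mathrm{out}}}):\mathbf{c}\in\mathcal{G}^0_{\mathrm{disc}}\}\subset\mathbb{R}^N.$$ **Initial data class.** For $\mathcal{G}\subset\mathbb{R}^N$ and $\pi^k(\mathbf{c})=c^k$, $L^\infty_{\mathrm{oco}}(\mathcal{G})$ is the set of $\mathbf{u}\in L^\infty(\Omega;\lambda)$ for which there exist $\mathbf{c},\mathbf{d}\in\mathcal{G}$ such that $[c^k,d^k]\subset\pi^k(\mathcal{G})$ for all $k\in\mathcal{I}$, $c^k\leq u^k(x)\leq d^k$ for (a.e.) $x\in D^k$ and all $k\in\mathcal{I}$, and $c^k\leq d^l$ for all $k,l\in\mathcal{I}$. *)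

theory Defs
  imports "HOL-Analysis.Analysis"
begin

definition idx_in :: "nat \<Rightarrow> int set" where
  "idx_in Nin = {- int Nin..-1}"

definition idx_out :: "nat \<Rightarrow> int set" where
  "idx_out Nout = {1..int Nout}"

definition idx :: "nat \<Rightarrow> nat \<Rightarrow> int set" where
  "idx Nin Nout = idx_in Nin \<union> idx_out Nout"

text \<open>Only the values at indices \<open>k < 0\<close> (ingoing) and \<open>k > 0\<close> (outgoing) are ever used.\<close>

definition edge :: "int \<Rightarrow> real set" where
  "edge k = (if k < 0 then {..<0} else {0<..})"

definition Omega :: "nat \<Rightarrow> nat \<Rightarrow> (real \<times> int) set" where
  "Omega Nin Nout = (\<Union>k\<in>idx Nin Nout. edge k \<times> {k})"

definition lambda_measure :: "nat \<Rightarrow> nat \<Rightarrow> (real \<times> int) measure" where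
  "lambda_measure Nin Nout =
     restrict_space (lebesgue \<Otimes>\<^sub>M count_space UNIV) (Omega Nin Nout)"

text \<open>
  Elements of \<open>L\<^sup>\<infinity>\<close> are represented by functions rather than by classes modulo null sets;
  the component \<open>u\<^sup>k\<close> of \<open>u\<close> is \<open>\<lambda>x. u (x, k)\<close>. Values of \<open>u\<close> outside \<open>\<Omega>\<close> are irrelevant.
  All sets of functions below are invariant under changes on null sets.
\<close>

definition L_infty :: "'a measure \<Rightarrow> ('a \<Rightarrow> real) set" where
  "L_infty M = {u \<in> borel_measurable M. \<exists>C. AE z in M. \<bar>u z\<bar> \<le> C}"

definition f_in :: "nat \<Rightarrow> (int \<Rightarrow> real \<Rightarrow> real) \<Rightarrow> real \<Rightarrow> real" where
  "f_in Nin f x = (\<Sum>k\<in>idx_in Nin. f k x)"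

definition f_out :: "nat \<Rightarrow> (int \<Rightarrow> real \<Rightarrow> real) \<Rightarrow> real \<Rightarrow> real" where
  "f_out Nout f x = (\<Sum>k\<in>idx_out Nout. f k x)"

definition R_in :: "nat \<Rightarrow> (int \<Rightarrow> real \<Rightarrow> real) \<Rightarrow> real set" where
  "R_in Nin f = range (f_in Nin f)"

definition R_out :: "nat \<Rightarrow> (int \<Rightarrow> real \<Rightarrow> real) \<Rightarrow> real set" where
  "R_out Nout f = range (f_out Nout f)"

definition I_in :: "nat \<Rightarrow> nat \<Rightarrow> (int \<Rightarrow> real \<Rightarrow> real) \<Rightarrow> real set" where
  "I_in Nin Nout f = f_in Nin f -` (R_in Nin f \<inter> R_out Nout f)"

definition I_out :: "nat \<Rightarrow> nat \<Rightarrow> (int \<Rightarrow> real \<Rightarrow> real) \<Rightarrow> real set" where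
  "I_out Nin Nout f = f_out Nout f -` (R_in Nin f \<inter> R_out Nout f)"

definition closed_interval :: "real set \<Rightarrow> bool" where
  "closed_interval S \<longleftrightarrow> is_interval S \<and> closed S"

definition upwind_flux :: "(int \<Rightarrow> real \<Rightarrow> real) \<Rightarrow> int \<Rightarrow> real \<Rightarrow> real \<Rightarrow> real" where
  "upwind_flux f k u v = f k u"

text \<open>
  A vector indexed by a set \<open>A\<close> of indices is a function in \<open>A \<rightarrow>\<^sub>E UNIV\<close>; here
  \<open>A = {-N\<^sub>i\<^sub>n..N\<^sub>o\<^sub>u\<^sub>t}\<close> is the index set of the network together with the node index 0.
\<close>

definition G0_disc :: "nat \<Rightarrow> nat \<Rightarrow> (int \<Rightarrow> real \<Rightarrow> real) \<Rightarrow> (int \<Rightarrow> real) set" where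
  "G0_disc Nin Nout f =
     {c \<in> {- int Nin..int Nout} \<rightarrow>\<^sub>E UNIV.
        (\<Sum>k\<in>idx_in Nin. f k (c k)) = (\<Sum>k\<in>idx_out Nout. f k (c k)) \<and>
        (\<forall>k\<in>idx_in Nin. upwind_flux f k (c k) (c 0) = f k (c k)) \<and>
        (\<forall>k\<in>idx_out Nout. upwind_flux f k (c 0) (c k) = f k (c k))}"

definition G_disc :: "nat \<Rightarrow> nat \<Rightarrow> (int \<Rightarrow> real \<Rightarrow> real) \<Rightarrow> (int \<Rightarrow> real) set" where
  "G_disc Nin Nout f = (\<lambda>c. restrict c (idx Nin Nout)) ` G0_disc Nin Nout f"

definition L_infty_oco ::
    "nat \<Rightarrow> nat \<Rightarrow> (int \<Rightarrow> real) set \<Rightarrow> (real \<times> int \<Rightarrow> real) set" where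
  "L_infty_oco Nin Nout G =
     {u \<in> L_infty (lambda_measure Nin Nout).
        \<exists>c\<in>G. \<exists>d\<in>G.
          (\<forall>k\<in>idx Nin Nout. {c k..d k} \<subseteq> (\<lambda>a. a k) ` G) \<and>
          (\<forall>k\<in>idx Nin Nout. AE x in lebesgue_on (edge k). c k \<le> u (x, k) \<and> u (x, k) \<le> d k) \<and>
          (\<forall>k\<in>idx Nin Nout. \<forall>l\<in>idx Nin Nout. c k \<le> d l)}"

definition data_class ::
    "nat \<Rightarrow> nat \<Rightarrow> (int \<Rightarrow> real \<Rightarrow> real) \<Rightarrow> (real \<times> int \<Rightarrow> real) set" where
  "data_class Nin Nout f =
     {u \<in> L_infty (lambda_measure Nin Nout).
        (\<forall>k\<in>idx_in Nin. AE x in lebesgue_on (edge k). u (x, k) \<in> I_in Nin Nout f) \<and>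
        (\<forall>k\<in>idx_out Nout. AE x in lebesgue_on (edge k). u (x, k) \<in> I_out Nin Nout f)}"

end

theory Submission
  imports Defs
begin

text \<open>
  A pair \<open>(x, y)\<close> with \<open>f\<^sub>i\<^sub>n(x) = f\<^sub>o\<^sub>u\<^sub>t(y)\<close> gives a stationary solution with value \<open>x\<close> on all
  ingoing and \<open>y\<close> on all outgoing edges. If \<open>R\<^sub>i\<^sub>n = R\<^sub>o\<^sub>u\<^sub>t\<close>, such a pair exists with \<open>x\<close> or \<open>y\<close>
  prescribed, so all projections of \<open>\<G>\<close> are \<open>\<real>\<close>; moreover both values can be pushed below
  \<open>-C\<close> (or above \<open>C\<close>) by solving for the smaller of \<open>f\<^sub>i\<^sub>n(-C)\<close>, \<open>f\<^sub>o\<^sub>u\<^sub>t(-C)\<close> (or the larger of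
  \<open>f\<^sub>i\<^sub>n(C)\<close>, \<open>f\<^sub>o\<^sub>u\<^sub>t(C)\<close>), which brackets every function bounded by \<open>C\<close>.

  The first claim reduces to this case: the ranges of the continuous strictly increasing
  functions \<open>f\<^sub>i\<^sub>n\<close>, \<open>f\<^sub>o\<^sub>u\<^sub>t\<close> are open, so \<open>I\<^sub>i\<^sub>n\<close> and \<open>I\<^sub>o\<^sub>u\<^sub>t\<close> are open as well as closed. Either
  both are \<open>\<real>\<close>, that is \<open>R\<^sub>i\<^sub>n = R\<^sub>o\<^sub>u\<^sub>t\<close>, or both are empty, and then so is \<open>\<L>\<close>.
\<close>

lemma strict_mono_sum:
  fixes f :: "'i \<Rightarrow> 'a::linorder \<Rightarrow> real"
  assumes "finite A" "A \<noteq> {}" "\<And>k. k \<in> A \<Longrightarrow> strict_mono (f k)"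
  shows "strict_mono (\<lambda>x. \<Sum>k\<in>A. f k x)"
  using assms by (auto simp: strict_mono_def intro!: sum_strict_mono)

lemma open_range_strict_mono:
  fixes g :: "real \<Rightarrow> real"
  assumes "continuous_on UNIV g" "strict_mono g"
  shows "open (range g)"
  using assms by (intro injective_into_1d_imp_open_map_UNIV[of UNIV UNIV])
    (auto intro: strict_mono_imp_inj_on)

lemma two_valued_in_G_disc:
  assumes "f_in Nin f x = f_out Nout f y"
  shows "(\<lambda>k\<in>idx Nin Nout. if k < 0 then x else y) \<in> G_disc Nin Nout f"
proof -
  \<comment> \<open>The node value \<open>?c 0\<close> is \<open>y\<close>: the upwind condition on
    an outgoing edge compares \<open>f k (?c 0)\<close> with \<open>f k (?c k)\<close>, while on
    ingoing edges the node value does not enter.\<close>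
  let ?c = "\<lambda>k\<in>{- int Nin..int Nout}. if k < 0 then x else y"
  have "(\<Sum>k\<in>idx_in Nin. f k (?c k)) = f_in Nin f x"
    unfolding f_in_def by (intro sum.cong) (auto simp: idx_in_def)
  moreover have "(\<Sum>k\<in>idx_out Nout. f k (?c k)) = f_out Nout f y"
    unfolding f_out_def by (intro sum.cong) (auto simp: idx_out_def)
  moreover have "\<forall>k\<in>idx_out Nout. upwind_flux f k (?c 0) (?c k) = f k (?c k)"
    by (auto simp: upwind_flux_def idx_out_def)
  ultimately have "?c \<in> G0_disc Nin Nout f"
    using assms unfolding G0_disc_def by (simp add: upwind_flux_def)
  moreover have "restrict ?c (idx Nin Nout) = (\<lambda>k\<in>idx Nin Nout. if k < 0 then x else y)"
    by (auto simp: restrict_def idx_def idx_in_def idx_out_def)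
  ultimately show ?thesis
    unfolding G_disc_def by (metis imageI)
qed

lemma projection_G_disc:
  assumes "R_in Nin f = R_out Nout f" "k \<in> idx Nin Nout"
  shows "(\<lambda>c. c k) ` G_disc Nin Nout f = UNIV"
proof -
  have "z \<in> (\<lambda>c. c k) ` G_disc Nin Nout f" for z
  proof -
    obtain x where x: "f_in Nin f x = f_out Nout f z"
      using assms(1) unfolding R_in_def R_out_def by (metis rangeE rangeI)
    obtain y where y: "f_in Nin f z = f_out Nout f y"
      using assms(1) unfolding R_in_def R_out_def by (metis rangeE rangeI)
    \<comment> \<open>The pair \<open>(z, y)\<close> puts \<open>z\<close> on the ingoing edges, the
      pair \<open>(x, z)\<close> on the outgoing ones.\<close>
    show ?thesis
      using assms(2) image_eqI[OF _ two_valued_in_G_disc[OF x], of z "\<lambda>c. c k"]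
        image_eqI[OF _ two_valued_in_G_disc[OF y], of z "\<lambda>c. c k"]
      by (cases "k < 0") auto
  qed
  then show ?thesis by blast
qed

text \<open>Completion keeps the space and the measure of the old sets, so the same countable cover
  works. This makes \<open>lebesgue\<close>, the completion of \<open>lborel\<close>, available for
  Fubini arguments.\<close>

lemma sigma_finite_completion:
  assumes "sigma_finite_measure M"
  shows "sigma_finite_measure (completion M)"
proof -
  obtain A where "countable A" "A \<subseteq> sets M" "\<Union>A = space M" "\<forall>a\<in>A. emeasure M a \<noteq> \<infinity>"
    using assms unfolding sigma_finite_measure_def by blast
  then show ?thesis
    unfolding sigma_finite_measure_def by (intro exI[of _ A]) (auto simp: subset_iff)
qed

text \<open>Fubini: almost every section of a null set is null, and for the counting measure only
  the empty set is null, so the condition holds at every index \<open>j\<close>.\<close>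

lemma AE_lambda_measure_edge:
  assumes "AE z in lambda_measure Nin Nout. P z" "k \<in> idx Nin Nout"
  shows "AE x in lebesgue_on (edge k). P (x, k)"
proof -
  let ?M = "lebesgue \<Otimes>\<^sub>M (count_space UNIV :: int measure)"
  interpret pair_sigma_finite "lebesgue :: real measure" "count_space (UNIV :: int set)"
    by (intro pair_sigma_finite.intro sigma_finite_completion
        lborel.sigma_finite_measure_axioms sigma_finite_measure_count_space)
  have edge: "edge j \<in> sets lebesgue" for j
    by (simp add: edge_def)
  have "Omega Nin Nout \<in> sets ?M"
    unfolding Omega_def using edge
    by (intro sets.finite_UN pair_measureI) (auto simp: idx_def idx_in_def idx_out_def)
  then have "AE z in ?M. z \<in> Omega Nin Nout \<longrightarrow> P z"
    using assms(1) unfolding lambda_measure_def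
    by (subst (asm) AE_restrict_space_iff) (auto simp: space_pair_measure)
  then have "AE x in lebesgue. \<forall>j. (x, j) \<in> Omega Nin Nout \<longrightarrow> P (x, j)"
    using AE_pair by (fastforce simp: AE_count_space)
  then have "AE x in lebesgue. x \<in> edge k \<longrightarrow> P (x, k)"
    by (rule AE_mp) (use assms(2) in \<open>auto simp: Omega_def\<close>)
  then show ?thesis
    using edge by (subst AE_restrict_space_iff) auto
qed

text \<open>Half-lines have positive measure, so no function takes values in an empty set a.e. on an
  edge.\<close>

lemma not_AE_False_edge: "\<not> (AE x in lebesgue_on (edge k). False)"
proof
  assume "AE x in lebesgue_on (edge k). False"
  moreover have edge: "edge k \<in> sets lebesgue"
    by (simp add: edge_def)
  ultimately have "AE x in lebesgue. x \<notin> edge k"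
    by (subst (asm) AE_restrict_space_iff) auto
  then have "negligible (edge k)"
    using edge by (simp add: AE_iff_null_sets negligible_iff_null_sets)
  moreover have "open (edge k)" "edge k \<noteq> {}"
    by (auto simp: edge_def lt_ex gt_ex)
  ultimately show False
    using open_not_negligible by blast
qed

lemma R_eq_of_closed_interval:
  assumes "continuous_on UNIV (f_in Nin f)" "strict_mono (f_in Nin f)"
    and "continuous_on UNIV (f_out Nout f)" "strict_mono (f_out Nout f)"
    and "closed (I_in Nin Nout f)" "closed (I_out Nin Nout f)" "I_in Nin Nout f \<noteq> {}"
  shows "R_in Nin f = R_out Nout f"
proof -
  have "open (R_in Nin f \<inter> R_out Nout f)"
    unfolding R_in_def R_out_def using assms(1-4) by (intro open_Int open_range_strict_mono)
  then have "open (I_in Nin Nout f)" "open (I_out Nin Nout f)"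
    unfolding I_in_def I_out_def using assms(1,3) by (auto simp del: vimage_Int intro: open_vimage)
  moreover have "I_out Nin Nout f \<noteq> {}"
  proof -
    obtain x y where "f_in Nin f x = f_out Nout f y"
      using assms(7) by (auto simp: I_in_def R_out_def)
    then have "y \<in> I_out Nin Nout f"
      unfolding I_out_def R_in_def R_out_def by (metis IntI rangeI vimageI2)
    then show ?thesis by blast
  qed
  \<comment> \<open>The real line is connected, so a nonempty clopen subset is everything; each
    range is then contained in the other.\<close>
  ultimately have "I_in Nin Nout f = UNIV" "I_out Nin Nout f = UNIV"
    using assms(5-7) clopen by blast+
  then show ?thesis
    by (auto simp: I_in_def I_out_def R_in_def R_out_def)
qed

lemma L_infty_subset_oco:
  assumes mono: "strict_mono (f_in Nin f)" "strict_mono (f_out Nout f)"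
    and R: "R_in Nin f = R_out Nout f"
  shows "L_infty (lambda_measure Nin Nout) \<subseteq> L_infty_oco Nin Nout (G_disc Nin Nout f)"
proof
  fix u assume u: "u \<in> L_infty (lambda_measure Nin Nout)"
  then obtain C0 where C0: "AE z in lambda_measure Nin Nout. \<bar>u z\<bar> \<le> C0"
    unfolding L_infty_def by blast
  \<comment> \<open>The sign of \<open>C0\<close> is not known; the absolute value secures
    \<open>- C \<le> C\<close>, which separates \<open>c k\<close> from \<open>d l\<close> across
    different edges.\<close>
  define C where "C = \<bar>C0\<bar>"
  have "AE z in lambda_measure Nin Nout. - C \<le> u z \<and> u z \<le> C"
    using C0 by (rule AE_mp) (auto simp: C_def)
  note bound = AE_lambda_measure_edge[OF this]
  have solve: "\<exists>x y. f_in Nin f x = m \<and> f_out Nout f y = m"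
    if "m \<in> R_in Nin f \<or> m \<in> R_out Nout f" for m
    using that R unfolding R_in_def R_out_def by (metis rangeE)
  obtain a a' where a: "f_in Nin f a = min (f_in Nin f (- C)) (f_out Nout f (- C))"
      "f_out Nout f a' = min (f_in Nin f (- C)) (f_out Nout f (- C))"
    using solve by (metis R_in_def R_out_def min_def rangeI)
  obtain b b' where b: "f_in Nin f b = max (f_in Nin f C) (f_out Nout f C)"
      "f_out Nout f b' = max (f_in Nin f C) (f_out Nout f C)"
    using solve by (metis R_in_def R_out_def max_def rangeI)
  have "f_in Nin f a \<le> f_in Nin f (- C)" "f_out Nout f a' \<le> f_out Nout f (- C)"
    "f_in Nin f C \<le> f_in Nin f b" "f_out Nout f C \<le> f_out Nout f b'"
    by (simp_all add: a b)
  then have le: "a \<le> - C" "a' \<le> - C" "C \<le> b" "C \<le> b'"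
    using mono by (simp_all add: strict_mono_less_eq)
  have "- C \<le> C"
    by (simp add: C_def)
  define c where "c = (\<lambda>k\<in>idx Nin Nout. if k < 0 then a else a')"
  define d where "d = (\<lambda>k\<in>idx Nin Nout. if k < 0 then b else b')"
  have cd: "c k \<le> - C" "C \<le> d k" if "k \<in> idx Nin Nout" for k
    using that le by (auto simp: c_def d_def)
  have "c \<in> G_disc Nin Nout f" "d \<in> G_disc Nin Nout f"
    unfolding c_def d_def using a b by (auto intro!: two_valued_in_G_disc)
  moreover have "\<forall>k\<in>idx Nin Nout. {c k..d k} \<subseteq> (\<lambda>e. e k) ` G_disc Nin Nout f"
    using projection_G_disc[OF R] by blast
  moreover have "\<forall>k\<in>idx Nin Nout. AE x in lebesgue_on (edge k). c k \<le> u (x, k) \<and> u (x, k) \<le> d k"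
  proof
    fix k assume k: "k \<in> idx Nin Nout"
    show "AE x in lebesgue_on (edge k). c k \<le> u (x, k) \<and> u (x, k) \<le> d k"
      using bound[OF k] by (rule AE_mp) (use cd[OF k] in auto)
  qed
  moreover have "\<forall>k\<in>idx Nin Nout. \<forall>l\<in>idx Nin Nout. c k \<le> d l"
    using cd \<open>- C \<le> C\<close> by (meson order_trans)
  ultimately show "u \<in> L_infty_oco Nin Nout (G_disc Nin Nout f)"
    using u unfolding L_infty_oco_def by blast
qed

theorem theorem6p1:
  fixes Nin Nout :: nat and f :: "int \<Rightarrow> real \<Rightarrow> real"
  assumes "Nin \<ge> 1" and "Nout \<ge> 1"
    and "\<forall>k\<in>idx Nin Nout. continuous_on UNIV (f k)"
    and "\<forall>k\<in>idx Nin Nout. strict_mono (f k)"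
  shows "(closed_interval (I_in Nin Nout f) \<and> closed_interval (I_out Nin Nout f) \<longrightarrow>
            data_class Nin Nout f \<subseteq> L_infty_oco Nin Nout (G_disc Nin Nout f)) \<and>
         (R_in Nin f = R_out Nout f \<longrightarrow>
            L_infty_oco Nin Nout (G_disc Nin Nout f) = L_infty (lambda_measure Nin Nout))"
proof -
  have cont: "continuous_on UNIV (f_in Nin f)" "continuous_on UNIV (f_out Nout f)"
    unfolding f_in_def f_out_def using assms(3)
    by (auto intro!: continuous_on_sum simp: idx_def)
  have mono: "strict_mono (f_in Nin f)" "strict_mono (f_out Nout f)"
    unfolding f_in_def f_out_def using assms
    by (auto intro!: strict_mono_sum simp: idx_def idx_in_def idx_out_def)
  have "data_class Nin Nout f \<subseteq> L_infty_oco Nin Nout (G_disc Nin Nout f)"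
    if "closed (I_in Nin Nout f)" "closed (I_out Nin Nout f)"
  proof (cases "I_in Nin Nout f = {}")
    case True
    have "-1 \<in> idx_in Nin"
      using assms(1) by (simp add: idx_in_def)
    then have "data_class Nin Nout f = {}"
      using not_AE_False_edge[of "-1"] by (auto simp: data_class_def True)
    then show ?thesis by simp
  next
    case False
    with that cont mono have "R_in Nin f = R_out Nout f"
      by (intro R_eq_of_closed_interval)
    from L_infty_subset_oco[OF mono this] show ?thesis
      unfolding data_class_def by blast
  qed
  then show ?thesis
    using L_infty_subset_oco[OF mono] by (auto simp: closed_interval_def L_infty_oco_def)
qed

end
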